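(* Let $f_1,\dots,f_T$ be base classifiers with values in $\{+1,-1\}$ and coefficients $\alpha_t>0$, $\sum_{t=1}^T\alpha_t=1$, let $\mathbf{x}_1,\dots,\mathbf{x}_N$ be the data points, and consider the noisy weighted-vote classifier described in the context, with base-classifier mismatch probabilities $p_1,\dots,p_T$. Put $$\widehat{p}_M=\sum_{t=1}^{T}\alpha_t p_t,\qquad \gamma_n=\left|\sum_{t=1}^{T}\alpha_t f_t(\mathbf{x}_n)\right|,$$ and assume $\gamma_n>0$ for all $n\in\{1,\dots,N\}$. Then for every $n$ the mismatch probability of $\mathbf{x}_n$ satisfies $$P_m(\mathbf{x}_n)\le\frac{2\,\widehat{p}_M}{\gamma_n},$$ and consequently the mismatch probability $P_m$ satisfies $$P_m\le\left(\frac{2}{N}\sum_{n=1}^{N}\frac{1}{\gamma_n}\right)\widehat{p}_M .$$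
   Context: Setting. The noise-free classifier is $f(\mathbf{x})=\operatorname{sign}\left(\sum_{t=1}^T\alpha_t f_t(\mathbf{x})\right)$, where $\operatorname{sign}$ takes values in $\{+1,-1\}$ (its value at $0$ is fixed by an arbitrary convention). At inference, each base classifier's output is randomly corrupted: for the data point $\mathbf{x}_n$, the output $f_t(\mathbf{x}_n)$ is replaced by a random $\widehat{f}_t(\mathbf{x}_n)\in\{+1,-1\}$. Let $\delta_{t,n}\in\{0,1\}$ be the indicator of the event $\widehat{f}_t(\mathbf{x}_n)\neq f_t(\mathbf{x}_n)$. For every $n$, $\mathbb{E}[\delta_{t,n}]=p_t$, where $p_t\in[0,1]$ is the mismatch probability of the $t$-th base classifier (it does not depend on $n$), and for each fixed $n$ the variables $\delta_{1,n},\dots,\delta_{T,n}$ are independent. The noisy classifier is $\widehat{f}(\mathbf{x}_n)=\operatorname{sign}\left(\sum_{t=1}^T\alpha_t\widehat{f}_t(\mathbf{x}_n)\right)$. The mismatch probability of $\mathbf{x}_n$ is $P_m(\mathbf{x}_n)=\Pr(\widehat{f}(\mathbf{x}_n)\neq f(\mathbf{x}_n))$, the probability being over the noise. The mismatch probability is $P_m=\frac1N\sum_{n=1}^N P_m(\mathbf{x}_n)$ (the expectation over the input is the empirical mean over the data set). *)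

theory Defs
  imports "HOL-Probability.Probability"
begin

text \<open>The sign with values in \<open>{1, -1}\<close>: \<open>s0\<close> is the value that the convention assigns to \<open>0\<close>.\<close>

definition sign_conv :: "real \<Rightarrow> real \<Rightarrow> real" where
  "sign_conv s0 y = (if y > 0 then 1 else if y < 0 then -1 else s0)"

definition classifier ::
  "real \<Rightarrow> nat \<Rightarrow> (nat \<Rightarrow> real) \<Rightarrow> (nat \<Rightarrow> 'x \<Rightarrow> real) \<Rightarrow> 'x \<Rightarrow> real" where
  "classifier s0 T \<alpha> f z = sign_conv s0 (\<Sum>t=1..T. \<alpha> t * f t z)"

text \<open>
  The noisy output of base classifier \<open>t\<close> at data point number \<open>n\<close> is a random variable \<open>fh t n\<close>
  on the noise space. It is indexed by \<open>n\<close> rather than by the point \<open>x n\<close>, so that data points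
  that happen to coincide may still receive different noise.
\<close>

definition noisy_classifier ::
  "real \<Rightarrow> nat \<Rightarrow> (nat \<Rightarrow> real) \<Rightarrow> (nat \<Rightarrow> nat \<Rightarrow> 'w \<Rightarrow> real) \<Rightarrow> nat \<Rightarrow> 'w \<Rightarrow> real" where
  "noisy_classifier s0 T \<alpha> fh n \<omega> = sign_conv s0 (\<Sum>t=1..T. \<alpha> t * fh t n \<omega>)"

definition flip_indicator ::
  "(nat \<Rightarrow> 'x \<Rightarrow> real) \<Rightarrow> (nat \<Rightarrow> 'x) \<Rightarrow> (nat \<Rightarrow> nat \<Rightarrow> 'w \<Rightarrow> real) \<Rightarrow> nat \<Rightarrow> nat \<Rightarrow> 'w \<Rightarrow> real" where
  "flip_indicator f x fh t n \<omega> = (if fh t n \<omega> \<noteq> f t (x n) then 1 else 0)"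

definition mismatch_prob_at ::
  "'w measure \<Rightarrow> real \<Rightarrow> nat \<Rightarrow> (nat \<Rightarrow> real) \<Rightarrow> (nat \<Rightarrow> 'x \<Rightarrow> real) \<Rightarrow> (nat \<Rightarrow> 'x)
    \<Rightarrow> (nat \<Rightarrow> nat \<Rightarrow> 'w \<Rightarrow> real) \<Rightarrow> nat \<Rightarrow> real" where
  "mismatch_prob_at M s0 T \<alpha> f x fh n =
     measure M {\<omega> \<in> space M. noisy_classifier s0 T \<alpha> fh n \<omega> \<noteq> classifier s0 T \<alpha> f (x n)}"

definition mismatch_prob ::
  "'w measure \<Rightarrow> real \<Rightarrow> nat \<Rightarrow> (nat \<Rightarrow> real) \<Rightarrow> (nat \<Rightarrow> 'x \<Rightarrow> real) \<Rightarrow> nat \<Rightarrow> (nat \<Rightarrow> 'x)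
    \<Rightarrow> (nat \<Rightarrow> nat \<Rightarrow> 'w \<Rightarrow> real) \<Rightarrow> real" where
  "mismatch_prob M s0 T \<alpha> f N x fh = 1 / real N * (\<Sum>n=1..N. mismatch_prob_at M s0 T \<alpha> f x fh n)"

definition mean_flip_prob :: "nat \<Rightarrow> (nat \<Rightarrow> real) \<Rightarrow> (nat \<Rightarrow> real) \<Rightarrow> real" where
  "mean_flip_prob T \<alpha> p = (\<Sum>t=1..T. \<alpha> t * p t)"

definition margin :: "nat \<Rightarrow> (nat \<Rightarrow> real) \<Rightarrow> (nat \<Rightarrow> 'x \<Rightarrow> real) \<Rightarrow> 'x \<Rightarrow> real" where
  "margin T \<alpha> f z = \<bar>\<Sum>t=1..T. \<alpha> t * f t z\<bar>"

end

(* The noisy and the clean vote differ by at most twice the total weight of the flipped classifiers.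
   If they have different signs, this difference is at least the margin, so the weight of the
   flipped classifiers is at least half the margin. Its expectation is the weighted mean of the
   flip probabilities, and Markov's inequality gives the bound. *)
theory Submission
  imports Defs
begin

text \<open>If \<open>a\<close> and \<open>b\<close> were both positive or both negative, the signs
  would agree. So 0 lies weakly between them and
  \<open>\<bar>a - b\<bar> = \<bar>a\<bar> + \<bar>b\<bar>\<close>, whichever value
  \<open>s0\<close> is given to the sign at 0.\<close>

lemma sign_conv_neq_imp_abs_le:
  assumes "sign_conv s0 a \<noteq> sign_conv s0 b"
  shows "\<bar>b\<bar> \<le> \<bar>a - b\<bar>"
  using assms by (auto simp: sign_conv_def split: if_splits)

text \<open>By the triangle inequality it suffices to compare term by term: an unflipped classifier
  contributes 0, and a flipped one contributes exactly \<open>2 * \<alpha> t\<close>, since the two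
  values 1 and -1 are at distance 2.\<close>

lemma vote_diff_le_flip_weight:
  assumes \<alpha>: "\<And>t. t \<in> {1..T} \<Longrightarrow> \<alpha> t \<ge> 0"
    and f: "\<And>t. t \<in> {1..T} \<Longrightarrow> f t (x n) \<in> {1, -1}"
    and fh: "\<And>t. t \<in> {1..T} \<Longrightarrow> fh t n \<omega> \<in> {1, -1}"
  shows "\<bar>(\<Sum>t=1..T. \<alpha> t * fh t n \<omega>) - (\<Sum>t=1..T. \<alpha> t * f t (x n))\<bar>
           \<le> 2 * (\<Sum>t=1..T. \<alpha> t * flip_indicator f x fh t n \<omega>)"
proof -
  have "\<bar>(\<Sum>t=1..T. \<alpha> t * fh t n \<omega>) - (\<Sum>t=1..T. \<alpha> t * f t (x n))\<bar>
          = \<bar>\<Sum>t=1..T. \<alpha> t * fh t n \<omega> - \<alpha> t * f t (x n)\<bar>"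
    by (simp add: sum_subtractf)
  also have "\<dots> \<le> (\<Sum>t=1..T. \<bar>\<alpha> t * fh t n \<omega> - \<alpha> t * f t (x n)\<bar>)"
    by (rule sum_abs)
  also have "\<dots> \<le> (\<Sum>t=1..T. 2 * (\<alpha> t * flip_indicator f x fh t n \<omega>))"
  proof (rule sum_mono)
    fix t assume "t \<in> {1..T}"
    from \<alpha>[OF this] f[OF this] fh[OF this]
    show "\<bar>\<alpha> t * fh t n \<omega> - \<alpha> t * f t (x n)\<bar> \<le> 2 * (\<alpha> t * flip_indicator f x fh t n \<omega>)"
      by (auto simp: flip_indicator_def)
  qed
  finally show ?thesis
    by (simp add: sum_distrib_left)
qed

text \<open>This is the bound at a single data point, which the theorem then averages over
  \<open>n\<close>. Markov's inequality is applied at half the margin, and halving the margin is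
  what produces the factor 2.\<close>

lemma (in prob_space) mismatch_prob_at_le:
  assumes \<alpha>: "\<And>t. t \<in> {1..T} \<Longrightarrow> \<alpha> t \<ge> 0"
    and f: "\<And>t. t \<in> {1..T} \<Longrightarrow> f t (x n) \<in> {1, -1}"
    and meas: "\<And>t. t \<in> {1..T} \<Longrightarrow> fh t n \<in> borel_measurable M"
    and fh: "\<And>t \<omega>. t \<in> {1..T} \<Longrightarrow> \<omega> \<in> space M \<Longrightarrow> fh t n \<omega> \<in> {1, -1}"
    and p: "\<And>t. t \<in> {1..T} \<Longrightarrow> (\<integral>\<omega>. flip_indicator f x fh t n \<omega> \<partial>M) = p t"
    and margin: "margin T \<alpha> f (x n) > 0"
  shows "mismatch_prob_at M s0 T \<alpha> f x fh n \<le> 2 * mean_flip_prob T \<alpha> p / margin T \<alpha> f (x n)"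
proof -
  \<comment> \<open>\<open>W\<close> is the random variable for Markov's inequality: the total
    weight that the noise flips at data point number \<open>n\<close>.\<close>
  define W where "W \<omega> = (\<Sum>t=1..T. \<alpha> t * flip_indicator f x fh t n \<omega>)" for \<omega>
  \<comment> \<open>The indicator is measurable because \<open>fh t n\<close> is, and it is bounded
    by 1 on a probability space.\<close>
  have int: "integrable M (flip_indicator f x fh t n)" if "t \<in> {1..T}" for t
  proof (rule integrable_const_bound[where B = 1])
    note [measurable] = meas[OF that]
    show "flip_indicator f x fh t n \<in> borel_measurable M"
      unfolding flip_indicator_def by measurable
  qed (simp add: flip_indicator_def)
  have int_W: "integrable M W"
    unfolding W_def by (intro Bochner_Integration.integrable_sum integrable_mult_right int)
  have "(\<integral>\<omega>. W \<omega> \<partial>M) = (\<Sum>t=1..T. \<alpha> t * (\<integral>\<omega>. flip_indicator f x fh t n \<omega> \<partial>M))"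
    unfolding W_def using int by (simp add: Bochner_Integration.integral_sum)
  also have "\<dots> = mean_flip_prob T \<alpha> p"
    unfolding mean_flip_prob_def using p by (intro sum.cong) simp_all
  finally have exp_W: "(\<integral>\<omega>. W \<omega> \<partial>M) = mean_flip_prob T \<alpha> p" .
  have W_nonneg: "W \<omega> \<ge> 0" for \<omega>
    unfolding W_def using \<alpha> by (intro sum_nonneg) (simp add: flip_indicator_def)
  have "mismatch_prob_at M s0 T \<alpha> f x fh n
          \<le> prob {\<omega> \<in> space M. W \<omega> \<ge> margin T \<alpha> f (x n) / 2}"
    unfolding mismatch_prob_at_def
  proof (rule finite_measure_mono)
    show "{\<omega> \<in> space M. noisy_classifier s0 T \<alpha> fh n \<omega> \<noteq> classifier s0 T \<alpha> f (x n)}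
            \<subseteq> {\<omega> \<in> space M. W \<omega> \<ge> margin T \<alpha> f (x n) / 2}"
    proof safe
      fix \<omega>
      assume \<omega>: "\<omega> \<in> space M" and "noisy_classifier s0 T \<alpha> fh n \<omega> \<noteq> classifier s0 T \<alpha> f (x n)"
      \<comment> \<open>The clean vote takes the role of \<open>b\<close> in the sign lemma, so its
        absolute value, the margin, bounds the difference from below.\<close>
      then have "margin T \<alpha> f (x n)
          \<le> \<bar>(\<Sum>t=1..T. \<alpha> t * fh t n \<omega>) - (\<Sum>t=1..T. \<alpha> t * f t (x n))\<bar>"
        unfolding noisy_classifier_def classifier_def margin_def
        by (intro sign_conv_neq_imp_abs_le)
      also have "\<dots> \<le> 2 * W \<omega>"
        unfolding W_def using \<alpha> f fh \<omega> by (intro vote_diff_le_flip_weight)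
      finally show "W \<omega> \<ge> margin T \<alpha> f (x n) / 2"
        by simp
    qed
    \<comment> \<open>Monotonicity of the measure asks for the larger set to be an event; it is a
      superlevel set of the measurable function \<open>W\<close>.\<close>
    show "{\<omega> \<in> space M. W \<omega> \<ge> margin T \<alpha> f (x n) / 2} \<in> events"
      using borel_measurable_integrable[OF int_W] by measurable
  qed
  \<comment> \<open>The positive margin makes the threshold positive, as Markov's inequality
    requires.\<close>
  also have "\<dots> \<le> (\<integral>\<omega>. W \<omega> \<partial>M) / (margin T \<alpha> f (x n) / 2)"
    using int_W W_nonneg margin by (intro integral_Markov_inequality_measure[where A = "{}"]) auto
  finally show ?thesis
    by (simp add: exp_W mult.commute)
qed

theorem theorem1:
  fixes M :: "'w measure"
    and s0 :: real
    and T N :: nat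
    and \<alpha> p :: "nat \<Rightarrow> real"
    and f :: "nat \<Rightarrow> 'x \<Rightarrow> real"
    and x :: "nat \<Rightarrow> 'x"
    and fh :: "nat \<Rightarrow> nat \<Rightarrow> 'w \<Rightarrow> real"
  assumes "prob_space M"
    and "s0 \<in> {1, -1}"
    and "N \<ge> 1"
    and "\<And>t z. t \<in> {1..T} \<Longrightarrow> f t z \<in> {1, -1}"
    and "\<And>t. t \<in> {1..T} \<Longrightarrow> \<alpha> t > 0"
    and "(\<Sum>t=1..T. \<alpha> t) = 1"
    and "\<And>t. t \<in> {1..T} \<Longrightarrow> p t \<in> {0..1}"
    and "\<And>t n. t \<in> {1..T} \<Longrightarrow> n \<in> {1..N} \<Longrightarrow> fh t n \<in> borel_measurable M"
    and "\<And>t n \<omega>. t \<in> {1..T} \<Longrightarrow> n \<in> {1..N} \<Longrightarrow> \<omega> \<in> space M \<Longrightarrow> fh t n \<omega> \<in> {1, -1}"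
    and "\<And>t n. t \<in> {1..T} \<Longrightarrow> n \<in> {1..N} \<Longrightarrow> (\<integral>\<omega>. flip_indicator f x fh t n \<omega> \<partial>M) = p t"
    and "\<And>n. n \<in> {1..N} \<Longrightarrow>
           prob_space.indep_vars M (\<lambda>_. borel) (\<lambda>t. flip_indicator f x fh t n) {1..T}"
    and "\<And>n. n \<in> {1..N} \<Longrightarrow> margin T \<alpha> f (x n) > 0"
  shows "(\<forall>n\<in>{1..N}. mismatch_prob_at M s0 T \<alpha> f x fh n
              \<le> 2 * mean_flip_prob T \<alpha> p / margin T \<alpha> f (x n))
       \<and> mismatch_prob M s0 T \<alpha> f N x fh
              \<le> (2 / real N * (\<Sum>n=1..N. 1 / margin T \<alpha> f (x n))) * mean_flip_prob T \<alpha> p"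
proof -
  interpret prob_space M
    by fact
  have bound: "mismatch_prob_at M s0 T \<alpha> f x fh n
      \<le> 2 * mean_flip_prob T \<alpha> p / margin T \<alpha> f (x n)" if "n \<in> {1..N}" for n
    using that assms(4,5,8,9,10,12) by (intro mismatch_prob_at_le) (auto intro: less_imp_le)
  \<comment> \<open>The pointwise bounds survive averaging because the weight
    \<open>1 / real N\<close> is nonnegative; the factor common to all \<open>n\<close> is then
    pulled out of the sum.\<close>
  have "mismatch_prob M s0 T \<alpha> f N x fh
      \<le> 1 / real N * (\<Sum>n=1..N. 2 * mean_flip_prob T \<alpha> p / margin T \<alpha> f (x n))"
    unfolding mismatch_prob_def by (intro mult_left_mono sum_mono bound) simp_all
  also have "\<dots> = (2 / real N * (\<Sum>n=1..N. 1 / margin T \<alpha> f (x n))) * mean_flip_prob T \<alpha> p"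
    by (simp add: sum_distrib_left sum_distrib_right mult_ac)
  finally show ?thesis
    using bound by blast
qed

end
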